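(* Let $\mathcal{G}_{\mathrm{out}}$ be the class of all influence graphs $G=(V,E,p)$ that are out-arborescences. Then, for the influence maximization problem in the independent cascade model with full-adoption feedback, $$\sup_{G\in\mathcal{G}_{\mathrm{out}},\,k\ge 1}\frac{\mathrm{OPT}_A(G,k)}{\mathrm{OPT}_N(G,k)}\le 2.$$
   Context: Independent cascade (IC) model: an influence graph is a directed graph $G=(V,E,p)$ with $|V|=n$ and a probability $p_{uv}\in[0,1]$ on each edge $(u,v)\in E$. A live-edge graph (realization) $\phi$ is a random subgraph of $G$ on $V$ in which each edge $(u,v)$ is present ("live") independently with probability $p_{uv}$; $\mathcal{P}$ denotes this distribution. For $S\subseteq V$, $\Gamma(S,\phi)$ is the set of nodes reachable from $S$ in $\phi$, and $\sigma(S)=\mathbb{E}_{\Phi\sim\mathcal{P}}[|\Gamma(S,\Phi)|]$. Full-adoption feedback: when a node $u$ is selected as a seed, one observes the live/blocked status of all out-going edges of every node reachable from $u$ in the realization. A partial realization $\psi$ records the seeds selected so far together with their observed feedback. An adaptive policy $\pi$ maps partial realizations to the next node to select; $V(\pi,\phi)$ is the seed set it selects under realization $\phi$, and $\sigma(\pi)=\mathbb{E}_{\Phi\sim\mathcal{P}}[|\Gamma(V(\pi,\Phi),\Phi)|]$. $\Pi(k)$ is the set of policies with $|V(\pi,\phi)|\le k$ for every realization $\phi$. $\mathrm{OPT}_N(G,k)=\max_{S\subseteq V,|S|\le k}\sigma(S)$ and $\mathrm{OPT}_A(G,k)=\sup_{\pi\in\Pi(k)}\sigma(\pi)$. An out-arborescence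 is an influence graph whose underlying graph is a directed tree with a root $r$ such that for every node $v$ the unique path between $r$ and $v$ is directed from $r$ to $v$. *)

theory Defs
  imports Complex_Main
begin

(* Influence graph: vertex set V, edge set E, edge probabilities p. *)
definition influence_graph :: "'a set \<Rightarrow> ('a \<times> 'a) set \<Rightarrow> ('a \<times> 'a \<Rightarrow> real) \<Rightarrow> bool" where
  "influence_graph V E p \<longleftrightarrow> finite V \<and> V \<noteq> {} \<and> E \<subseteq> V \<times> V \<and> (\<forall>e\<in>E. 0 \<le> p e \<and> p e \<le> 1)"

(* Out-arborescence with some root r: every node reachable from r by a directed path,
   r has in-degree 0, every other node has in-degree exactly 1. *)
definition out_arborescence :: "'a set \<Rightarrow> ('a \<times> 'a) set \<Rightarrow> bool" where
  "out_arborescence V E \<longleftrightarrow> E \<subseteq> V \<times> V \<and>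
     (\<exists>r\<in>V. (\<forall>v\<in>V. (r, v) \<in> E\<^sup>*) \<and>
              (\<forall>v\<in>V. card {u. (u, v) \<in> E} = (if v = r then 0 else 1)))"

(* Gamma(S, phi): nodes reachable from S in the live-edge graph phi *)
definition reach :: "('a \<times> 'a) set \<Rightarrow> 'a set \<Rightarrow> 'a set" where
  "reach \<phi> S = \<phi>\<^sup>* `` S"

(* Probability of realization phi (phi \<subseteq> E): independent live edges *)
definition real_prob :: "('a \<times> 'a) set \<Rightarrow> ('a \<times> 'a \<Rightarrow> real) \<Rightarrow> ('a \<times> 'a) set \<Rightarrow> real" where
  "real_prob E p \<phi> = (\<Prod>e\<in>E. if e \<in> \<phi> then p e else 1 - p e)"

(* sigma(S) = E_phi |Gamma(S,phi)|, realizations range over subsets of E *)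
definition sigma_N :: "('a \<times> 'a) set \<Rightarrow> ('a \<times> 'a \<Rightarrow> real) \<Rightarrow> 'a set \<Rightarrow> real" where
  "sigma_N E p S = (\<Sum>\<phi>\<in>Pow E. real_prob E p \<phi> * real (card (reach \<phi> S)))"

(* Full-adoption feedback of seed u: status (live = True / blocked = False) of every
   out-going edge of every node reachable from u; None = unobserved. *)
definition feedback :: "('a \<times> 'a) set \<Rightarrow> ('a \<times> 'a) set \<Rightarrow> 'a \<Rightarrow> ('a \<times> 'a \<Rightarrow> bool option)" where
  "feedback E \<phi> u = (\<lambda>e. if e \<in> E \<and> fst e \<in> reach \<phi> {u} then Some (e \<in> \<phi>) else None)"

(* partial realization: list of selected seeds with their observed feedback;
   adaptive policy: maps a partial realization to the next seed, or None = stop *)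
type_synonym 'a partial_realization = "('a \<times> ('a \<times> 'a \<Rightarrow> bool option)) list"
type_synonym 'a policy = "'a partial_realization \<Rightarrow> 'a option"

primrec history :: "('a \<times> 'a) set \<Rightarrow> 'a policy \<Rightarrow> ('a \<times> 'a) set \<Rightarrow> nat \<Rightarrow> 'a partial_realization" where
  "history E \<pi> \<phi> 0 = []"
| "history E \<pi> \<phi> (Suc n) =
     (case \<pi> (history E \<pi> \<phi> n) of
        None \<Rightarrow> history E \<pi> \<phi> n
      | Some v \<Rightarrow> history E \<pi> \<phi> n @ [(v, feedback E \<phi> v)])"

(* V(pi, phi): set of seeds selected by pi under realization phi *)
definition policy_seeds :: "('a \<times> 'a) set \<Rightarrow> 'a policy \<Rightarrow> ('a \<times> 'a) set \<Rightarrow> 'a set" where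
  "policy_seeds E \<pi> \<phi> = (\<Union>n. fst ` set (history E \<pi> \<phi> n))"

definition sigma_A :: "('a \<times> 'a) set \<Rightarrow> ('a \<times> 'a \<Rightarrow> real) \<Rightarrow> 'a policy \<Rightarrow> real" where
  "sigma_A E p \<pi> = (\<Sum>\<phi>\<in>Pow E. real_prob E p \<phi> * real (card (reach \<phi> (policy_seeds E \<pi> \<phi>))))"

(* Pi(k): policies selecting nodes of V, with at most k seeds under every realization *)
definition policies :: "'a set \<Rightarrow> ('a \<times> 'a) set \<Rightarrow> nat \<Rightarrow> 'a policy set" where
  "policies V E k = {\<pi>. (\<forall>\<psi> v. \<pi> \<psi> = Some v \<longrightarrow> v \<in> V) \<and>
                        (\<forall>\<phi>. \<phi> \<subseteq> E \<longrightarrow> card (policy_seeds E \<pi> \<phi>) \<le> k)}"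

definition OPT_A :: "'a set \<Rightarrow> ('a \<times> 'a) set \<Rightarrow> ('a \<times> 'a \<Rightarrow> real) \<Rightarrow> nat \<Rightarrow> real" where
  "OPT_A V E p k = (SUP \<pi>\<in>policies V E k. sigma_A E p \<pi>)"

definition OPT_N :: "'a set \<Rightarrow> ('a \<times> 'a) set \<Rightarrow> ('a \<times> 'a \<Rightarrow> real) \<Rightarrow> nat \<Rightarrow> real" where
  "OPT_N V E p k = Max (sigma_N E p ` {S. S \<subseteq> V \<and> card S \<le> k})"

end

theory Submission
  imports Defs
begin

text \<open>
  Given an adaptive policy, let \<open>x u\<close> be the probability that it selects \<open>u\<close>, and draw \<open>k\<close>
  independent seeds from the distribution \<open>x / k\<close>. Let \<open>u\<^sub>0 = v, u\<^sub>1, \<dots>, u\<^sub>m\<close> be the ancestors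
  of a node \<open>v\<close>, and let \<open>q\<^sub>j\<close> be the probability that the path from \<open>u\<^sub>j\<close> to \<open>v\<close> is live. The first
  selected seed that reaches \<open>v\<close> is selected before any edge on its path to \<open>v\<close> is observed. Hence
  the policy activates \<open>v\<close> with probability \<open>P \<le> q\<^sub>j + (\<Sum>i<j. x u\<^sub>i * q\<^sub>i)\<close> for all \<open>j\<close>. The random
  seed set activates \<open>v\<close> with probability at least
  \<open>\<Sum>j. (q\<^sub>j - q\<^sub>j\<^sub>+\<^sub>1) * (1 - exp (- (\<Sum>i\<le>j. x u\<^sub>i)))\<close>, and these inequalities force this to be at
  least \<open>P / 2\<close>.
\<close>

section \<open>Independent live edges: probabilities of sets of realizations\<close>

definition event_prob :: "('a \<times> 'a) set \<Rightarrow> ('a \<times> 'a \<Rightarrow> real) \<Rightarrow> ('a \<times> 'a) set set \<Rightarrow> real" where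
  "event_prob E p A = (\<Sum>\<phi>\<in>A. real_prob E p \<phi>)"

lemma real_prob_nonneg:
  assumes "\<forall>e\<in>E. 0 \<le> p e \<and> p e \<le> 1"
  shows "0 \<le> real_prob E p \<phi>"
  unfolding real_prob_def using assms by (intro prod_nonneg) auto

lemma sum_real_prob:
  assumes "finite E"
  shows "(\<Sum>\<phi>\<in>Pow E. real_prob E p \<phi>) = 1"
proof -
  have "(\<Sum>\<phi>\<in>Pow E. real_prob E p \<phi>) = (\<Sum>\<phi>\<in>Pow E. (\<Prod>e\<in>\<phi>. p e) * (\<Prod>e\<in>E - \<phi>. 1 - p e))"
  proof (rule sum.cong[OF refl])
    fix \<phi> assume "\<phi> \<in> Pow E"
    then have "\<phi> \<subseteq> E" by simp
    then have "real_prob E p \<phi> =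
        (\<Prod>e\<in>E - \<phi>. if e \<in> \<phi> then p e else 1 - p e) * (\<Prod>e\<in>\<phi>. if e \<in> \<phi> then p e else 1 - p e)"
      unfolding real_prob_def using assms by (intro prod.subset_diff)
    then show "real_prob E p \<phi> = (\<Prod>e\<in>\<phi>. p e) * (\<Prod>e\<in>E - \<phi>. 1 - p e)" by simp
  qed
  also have "\<dots> = (\<Prod>e\<in>E. p e + (1 - p e))" by (rule prod_add[OF assms, symmetric])
  finally show ?thesis by simp
qed

lemma real_prob_split:
  assumes "finite E" "C \<subseteq> E" "\<psi> \<subseteq> E - C" "D \<subseteq> C"
  shows "real_prob E p (\<psi> \<union> D) = real_prob (E - C) p \<psi> * real_prob C p D"
proof -
  have "real_prob E p (\<psi> \<union> D) = (\<Prod>e\<in>E - C. if e \<in> \<psi> \<union> D then p e else 1 - p e)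
      * (\<Prod>e\<in>C. if e \<in> \<psi> \<union> D then p e else 1 - p e)"
    unfolding real_prob_def using assms by (intro prod.subset_diff) auto
  also have "(\<Prod>e\<in>E - C. if e \<in> \<psi> \<union> D then p e else 1 - p e) = real_prob (E - C) p \<psi>"
    unfolding real_prob_def using assms by (intro prod.cong) auto
  also have "(\<Prod>e\<in>C. if e \<in> \<psi> \<union> D then p e else 1 - p e) = real_prob C p D"
    unfolding real_prob_def using assms by (intro prod.cong) auto
  finally show ?thesis .
qed

text \<open>Fubini for the product measure: the edges outside \<open>C\<close> are fixed first, and
  those in \<open>C\<close> are then fresh independent coins.\<close>

lemma sum_real_prob_split:
  assumes "finite E" "C \<subseteq> E"
  shows "(\<Sum>\<phi>\<in>Pow E. real_prob E p \<phi> * h \<phi>) =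
    (\<Sum>\<psi>\<in>Pow (E - C). real_prob (E - C) p \<psi> * (\<Sum>D\<in>Pow C. real_prob C p D * h (\<psi> \<union> D)))"
proof -
  have "(\<Sum>\<phi>\<in>Pow E. real_prob E p \<phi> * h \<phi>) =
      (\<Sum>(\<psi>, D)\<in>Pow (E - C) \<times> Pow C. real_prob E p (\<psi> \<union> D) * h (\<psi> \<union> D))"
    using assms
    by (intro sum.reindex_bij_witness[where i = "\<lambda>(\<psi>, D). \<psi> \<union> D" and j = "\<lambda>\<phi>. (\<phi> - C, \<phi> \<inter> C)"])
      (auto simp: Un_Diff Int_Un_distrib2 simp flip: Un_Diff_Int intro!: arg_cong2[where f = "(*)"] arg_cong[where f = h] arg_cong[where f = "real_prob E p"])
  also have "\<dots> = (\<Sum>(\<psi>, D)\<in>Pow (E - C) \<times> Pow C.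
      real_prob (E - C) p \<psi> * (real_prob C p D * h (\<psi> \<union> D)))"
    using assms by (intro sum.cong) (auto simp: real_prob_split)
  also have "\<dots> = (\<Sum>\<psi>\<in>Pow (E - C). \<Sum>D\<in>Pow C. real_prob (E - C) p \<psi> * (real_prob C p D * h (\<psi> \<union> D)))"
    by (rule sum.cartesian_product[symmetric])
  finally show ?thesis by (simp add: sum_distrib_left)
qed

lemma event_prob_indicator:
  assumes "finite E" "A \<subseteq> Pow E"
  shows "event_prob E p A = (\<Sum>\<phi>\<in>Pow E. real_prob E p \<phi> * of_bool (\<phi> \<in> A))"
proof -
  have "Pow E \<inter> {\<phi>. \<phi> \<in> A} = A" using assms by auto
  then show ?thesis using assms by (simp add: event_prob_def of_bool_def if_distrib sum.If_cases cong: if_cong)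
qed

lemma real_prob_self: "real_prob C p C = prod p C"
  by (simp add: real_prob_def)

lemma event_prob_live_edges:
  assumes "finite E" "C \<subseteq> E"
  shows "event_prob E p {\<phi>\<in>Pow E. C \<subseteq> \<phi>} = prod p C"
proof -
  have inner: "(\<Sum>D\<in>Pow C. real_prob C p D * of_bool (\<psi> \<union> D \<in> {\<phi>\<in>Pow E. C \<subseteq> \<phi>})) = prod p C"
    if "\<psi> \<in> Pow (E - C)" for \<psi>
  proof -
    have "(\<Sum>D\<in>Pow C. real_prob C p D * of_bool (\<psi> \<union> D \<in> {\<phi>\<in>Pow E. C \<subseteq> \<phi>})) =
        (\<Sum>D\<in>Pow C. if D = C then real_prob C p D else 0)"
      using that assms by (intro sum.cong) auto
    then show ?thesis using assms by (simp add: finite_subset real_prob_self)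
  qed
  have "event_prob E p {\<phi>\<in>Pow E. C \<subseteq> \<phi>} = (\<Sum>\<psi>\<in>Pow (E - C). real_prob (E - C) p \<psi> * prod p C)"
    using assms(1)
    by (subst event_prob_indicator) (simp_all only: sum_real_prob_split[OF assms] inner cong: sum.cong, auto)
  then show ?thesis using assms by (simp add: sum_real_prob flip: sum_distrib_right)
qed

text \<open>Independence in the form of resampling: \<open>B\<close> must contain whatever arises
  from a member of \<open>A\<close> by changing the edges of \<open>C\<close> arbitrarily. With the
  edges outside \<open>C\<close> fixed, at most the single outcome \<open>D = C\<close> falls into
  \<open>A\<close>, with mass \<open>prod p C\<close>; if it does, all outcomes fall into
  \<open>B\<close>, with mass 1.\<close>

lemma event_prob_resample:
  assumes "finite E" "C \<subseteq> E" "\<forall>e\<in>E. 0 \<le> p e \<and> p e \<le> 1"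
    and A: "A \<subseteq> Pow E" "\<And>\<phi>. \<phi> \<in> A \<Longrightarrow> C \<subseteq> \<phi>"
    and B: "B \<subseteq> Pow E" "\<And>\<phi> D. \<phi> \<in> A \<Longrightarrow> D \<subseteq> C \<Longrightarrow> (\<phi> - C) \<union> D \<in> B"
  shows "event_prob E p A \<le> event_prob E p B * prod p C"
proof -
  have finC: "finite C" by (rule finite_subset[OF assms(2,1)])
  have p0: "0 \<le> real_prob C p D" "0 \<le> real_prob (E - C) p D" for D
    using assms by (auto intro!: real_prob_nonneg)
  have pC: "0 \<le> prod p C" using assms by (intro prod_nonneg) auto
  have inner: "(\<Sum>D\<in>Pow C. real_prob C p D * of_bool (\<psi> \<union> D \<in> A)) \<le>
      (\<Sum>D\<in>Pow C. real_prob C p D * of_bool (\<psi> \<union> D \<in> B)) * prod p C"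
    if \<psi>: "\<psi> \<in> Pow (E - C)" for \<psi>
  proof (cases "\<psi> \<union> C \<in> A")
    case True
    have "(\<Sum>D\<in>Pow C. real_prob C p D * of_bool (\<psi> \<union> D \<in> B)) = (\<Sum>D\<in>Pow C. real_prob C p D)"
    proof (rule sum.cong[OF refl])
      fix D assume "D \<in> Pow C"
      then have "(\<psi> \<union> C - C) \<union> D \<in> B" using B(2)[OF True] by simp
      moreover have "(\<psi> \<union> C - C) \<union> D = \<psi> \<union> D" using \<psi> by auto
      ultimately show "real_prob C p D * of_bool (\<psi> \<union> D \<in> B) = real_prob C p D" by simp
    qed
    moreover have "(\<Sum>D\<in>Pow C. real_prob C p D * of_bool (\<psi> \<union> D \<in> A)) =
        (\<Sum>D\<in>Pow C. if D = C then real_prob C p D else 0)"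
      using True A(2) \<psi> by (intro sum.cong) fastforce+
    ultimately show ?thesis using finC by (simp add: sum_real_prob real_prob_self)
  next
    case False
    have "(\<Sum>D\<in>Pow C. real_prob C p D * of_bool (\<psi> \<union> D \<in> A)) = 0"
    proof (rule sum.neutral, rule ballI)
      fix D assume D: "D \<in> Pow C"
      have "\<psi> \<union> D \<notin> A"
      proof
        assume *: "\<psi> \<union> D \<in> A"
        then have "C \<subseteq> \<psi> \<union> D" by (rule A(2))
        then have "D = C" using \<psi> D by auto
        then show False using * False by simp
      qed
      then show "real_prob C p D * of_bool (\<psi> \<union> D \<in> A) = 0" by simp
    qed
    then show ?thesis using p0 pC by (auto intro!: mult_nonneg_nonneg sum_nonneg)
  qed
  have "event_prob E p A =
      (\<Sum>\<psi>\<in>Pow (E - C). real_prob (E - C) p \<psi> * (\<Sum>D\<in>Pow C. real_prob C p D * of_bool (\<psi> \<union> D \<in> A)))"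
    using assms by (simp only: event_prob_indicator sum_real_prob_split)
  also have "\<dots> \<le> (\<Sum>\<psi>\<in>Pow (E - C). real_prob (E - C) p \<psi> *
      ((\<Sum>D\<in>Pow C. real_prob C p D * of_bool (\<psi> \<union> D \<in> B)) * prod p C))"
    using inner p0 by (intro sum_mono mult_left_mono) auto
  also have "\<dots> = (\<Sum>\<psi>\<in>Pow (E - C). real_prob (E - C) p \<psi> *
      (\<Sum>D\<in>Pow C. real_prob C p D * of_bool (\<psi> \<union> D \<in> B))) * prod p C"
    by (simp add: sum_distrib_right mult.assoc)
  also have "\<dots> = event_prob E p B * prod p C"
    using assms by (simp only: event_prob_indicator sum_real_prob_split)
  finally show ?thesis .
qed

lemma event_prob_mono:
  assumes "finite E" "\<forall>e\<in>E. 0 \<le> p e \<and> p e \<le> 1" "A \<subseteq> B" "B \<subseteq> Pow E"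
  shows "event_prob E p A \<le> event_prob E p B"
  unfolding event_prob_def using assms
  by (intro sum_mono2) (auto intro: real_prob_nonneg finite_subset)

lemma event_prob_Un:
  assumes "finite E" "\<forall>e\<in>E. 0 \<le> p e \<and> p e \<le> 1" "A \<subseteq> Pow E" "B \<subseteq> Pow E"
  shows "event_prob E p (A \<union> B) \<le> event_prob E p A + event_prob E p B"
proof -
  have "finite A" "finite B" using assms by (auto intro: finite_subset)
  then have "event_prob E p A + event_prob E p B =
      event_prob E p (A \<union> B) + event_prob E p (A \<inter> B)"
    unfolding event_prob_def by (rule sum.union_inter[symmetric])
  moreover have "0 \<le> event_prob E p (A \<inter> B)"
    unfolding event_prob_def using assms by (intro sum_nonneg real_prob_nonneg)
  ultimately show ?thesis by linarith
qed

lemma event_prob_UN: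
  fixes n :: nat
  assumes "finite E" "\<forall>e\<in>E. 0 \<le> p e \<and> p e \<le> 1" "\<And>i. A i \<subseteq> Pow E"
  shows "event_prob E p (\<Union>i<n. A i) \<le> (\<Sum>i<n. event_prob E p (A i))"
proof (induction n)
  case 0
  then show ?case by (simp add: event_prob_def)
next
  case (Suc n)
  have "event_prob E p (\<Union>i<Suc n. A i) = event_prob E p ((\<Union>i<n. A i) \<union> A n)"
    by (simp add: lessThan_Suc Un_commute)
  also have "\<dots> \<le> event_prob E p (\<Union>i<n. A i) + event_prob E p (A n)"
    using assms by (intro event_prob_Un) auto
  finally show ?case using Suc.IH by simp
qed

text \<open>Linearity of expectation. It serves both influence functions and the expected number of
  seeds of a policy.\<close>

lemma expected_card:
  assumes "finite E" "finite V" "\<And>\<phi>. \<phi> \<subseteq> E \<Longrightarrow> X \<phi> \<subseteq> V"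
  shows "(\<Sum>\<phi>\<in>Pow E. real_prob E p \<phi> * real (card (X \<phi>))) =
    (\<Sum>v\<in>V. event_prob E p {\<phi>\<in>Pow E. v \<in> X \<phi>})"
proof -
  have card: "real (card (X \<phi>)) = (\<Sum>v\<in>V. of_bool (v \<in> X \<phi>))" if "\<phi> \<subseteq> E" for \<phi>
  proof -
    have "V \<inter> {v. v \<in> X \<phi>} = X \<phi>" using assms(3)[OF that] by auto
    then show ?thesis using assms(2) by (simp add: of_bool_def sum.If_cases)
  qed
  have "(\<Sum>\<phi>\<in>Pow E. real_prob E p \<phi> * real (card (X \<phi>))) =
      (\<Sum>\<phi>\<in>Pow E. \<Sum>v\<in>V. real_prob E p \<phi> * of_bool (v \<in> X \<phi>))"
    by (intro sum.cong) (auto simp: card sum_distrib_left)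
  also have "\<dots> = (\<Sum>v\<in>V. \<Sum>\<phi>\<in>Pow E. real_prob E p \<phi> * of_bool (v \<in> X \<phi>))"
    by (rule sum.swap)
  also have "\<dots> = (\<Sum>v\<in>V. event_prob E p {\<phi>\<in>Pow E. v \<in> X \<phi>})"
    using assms(1)
    by (intro sum.cong refl, subst event_prob_indicator) (auto intro!: sum.cong)
  finally show ?thesis .
qed

subsection \<open>Chains of ancestors\<close>

text \<open>Indices grow from \<open>v\<close> towards the root. The last clause excludes any other
  incoming edge along the chain and any edge into \<open>u m\<close>; this is all that later
  arguments use of the arborescence.\<close>

definition ancestor_chain :: "('a \<times> 'a) set \<Rightarrow> 'a \<Rightarrow> nat \<Rightarrow> (nat \<Rightarrow> 'a) \<Rightarrow> bool" where
  "ancestor_chain E v m u \<longleftrightarrow> u 0 = v \<and> (\<forall>i<m. (u (Suc i), u i) \<in> E) \<and>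
     (\<forall>i\<le>m. \<forall>y. (y, u i) \<in> E \<longrightarrow> i < m \<and> y = u (Suc i))"

definition chain_edges :: "(nat \<Rightarrow> 'a) \<Rightarrow> nat \<Rightarrow> ('a \<times> 'a) set" where
  "chain_edges u i = (\<lambda>l. (u (Suc l), u l)) ` {..<i}"

lemma chain_edges_simps [simp]:
  "chain_edges u 0 = {}"
  "chain_edges u (Suc i) = insert (u (Suc i), u i) (chain_edges u i)"
  by (auto simp: chain_edges_def lessThan_Suc)

lemma chain_edges_mono: "i \<le> j \<Longrightarrow> chain_edges u i \<subseteq> chain_edges u j"
  unfolding chain_edges_def by (intro image_mono) auto

lemma ancestor_chain_exists:
  assumes "out_arborescence V E" "finite E" "v \<in> V"
  obtains m u where "ancestor_chain E v m u"
proof -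
  obtain r where r: "r \<in> V" "(r, v) \<in> E\<^sup>*"
    and deg: "\<And>v. v \<in> V \<Longrightarrow> card {u. (u, v) \<in> E} = (if v = r then 0 else 1)"
    and EV: "E \<subseteq> V \<times> V"
    using assms(1,3) unfolding out_arborescence_def by blast
  \<comment> \<open>An infinite set has \<open>card\<close> 0, so finiteness is what turns in-degree
    0 into the absence of parents.\<close>
  have fin: "finite {u. (u, w) \<in> E}" for w
    by (rule finite_subset[of _ "fst ` E"]) (use assms(2) in force)+
  have root: "(y, r) \<notin> E" for y using deg[OF r(1)] fin[of r] by auto
  have parent: "y = z" if "(y, w) \<in> E" "(z, w) \<in> E" for y z w
  proof -
    have "w \<in> V" "w \<noteq> r" using that EV root by auto
    then have "card {u. (u, w) \<in> E} = 1" using deg by simp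
    then obtain t where "{u. (u, w) \<in> E} = {t}" by (rule card_1_singletonE)
    then show ?thesis using that by (metis mem_Collect_eq singletonD)
  qed
  have "\<exists>m u. ancestor_chain E v m u"
    using r(2)
  proof (induction rule: rtrancl_induct)
    case base
    have "ancestor_chain E r 0 (\<lambda>_. r)" using root by (simp add: ancestor_chain_def)
    then show ?case by blast
  next
    case (step y z)
    then obtain m u where u: "ancestor_chain E y m u" by blast
    \<comment> \<open>\<open>z\<close> takes index 0 and the chain of its parent \<open>y\<close>
      shifts up by one.\<close>
    have "ancestor_chain E z (Suc m) (case_nat z u)"
      unfolding ancestor_chain_def
    proof (intro conjI allI impI)
      fix i assume "i < Suc m"
      then show "(case_nat z u (Suc i), case_nat z u i) \<in> E"
        using u step.hyps(2) by (cases i) (auto simp: ancestor_chain_def)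
    next
      fix i w assume i: "i \<le> Suc m" and w: "(w, case_nat z u i) \<in> E"
      show "i < Suc m"
        using u i w by (cases i) (auto simp: ancestor_chain_def)
      show "w = case_nat z u (Suc i)"
        using u i w parent[OF _ step.hyps(2), of w] by (cases i) (auto simp: ancestor_chain_def)
    qed simp
    then show ?case by blast
  qed
  then show ?thesis using that by blast
qed

lemma ancestor_chain_edges_subset:
  assumes "ancestor_chain E v m u" "i \<le> m"
  shows "chain_edges u i \<subseteq> E"
  using assms unfolding ancestor_chain_def chain_edges_def by auto

text \<open>If \<open>u i = u j\<close> with \<open>i < j\<close>, then climbing from both in
  parallel keeps the nodes equal until the larger index is \<open>m\<close>. Then \<open>u m\<close>
  equals a node of smaller index, which has a parent, whereas \<open>u m\<close> has none.\<close>

lemma ancestor_chain_inj: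
  assumes "ancestor_chain E v m u"
  shows "inj_on u {..m}"
proof -
  have False if ij: "i < j" "j \<le> m" and eq: "u i = u j" for i j
  proof -
    have "j + t \<le> m \<Longrightarrow> u (i + t) = u (j + t)" for t
    proof (induction t)
      case (Suc t)
      then have "(u (Suc (j + t)), u (i + t)) \<in> E"
        using assms unfolding ancestor_chain_def by auto
      then have "u (Suc (j + t)) = u (Suc (i + t))"
        using assms Suc.prems ij unfolding ancestor_chain_def by auto
      then show ?case by simp
    qed (use eq in simp)
    from this[of "m - j"] have "u (i + (m - j)) = u m" using ij by simp
    moreover have "(u (Suc (i + (m - j))), u (i + (m - j))) \<in> E"
      using assms ij unfolding ancestor_chain_def by auto
    ultimately show False using assms unfolding ancestor_chain_def by auto
  qed
  then show ?thesis by (intro linorder_inj_onI') (metis atMost_iff)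
qed

text \<open>Traversed backwards from \<open>v\<close>, a live path has only one possible parent at
  each node, so it follows the chain.\<close>

lemma ancestor_chain_reach_iff:
  assumes "ancestor_chain E v m u" "\<phi> \<subseteq> E"
  shows "(s, v) \<in> \<phi>\<^sup>* \<longleftrightarrow> (\<exists>i\<le>m. s = u i \<and> chain_edges u i \<subseteq> \<phi>)"
proof
  assume "(s, v) \<in> \<phi>\<^sup>*"
  then show "\<exists>i\<le>m. s = u i \<and> chain_edges u i \<subseteq> \<phi>"
  proof (induction rule: converse_rtrancl_induct)
    case base
    then show ?case using assms(1) unfolding ancestor_chain_def by (intro exI[of _ 0]) auto
  next
    case (step y z)
    then obtain i where i: "i \<le> m" "z = u i" "chain_edges u i \<subseteq> \<phi>" by auto
    then have "(y, u i) \<in> E" using step.hyps assms(2) by auto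
    then have "i < m" "y = u (Suc i)" using assms(1) i unfolding ancestor_chain_def by auto
    then show ?case using i step.hyps by (intro exI[of _ "Suc i"]) auto
  qed
next
  have "chain_edges u i \<subseteq> \<phi> \<Longrightarrow> (u i, v) \<in> \<phi>\<^sup>*" for i
    using assms(1)
    by (induction i) (auto simp: ancestor_chain_def intro: converse_rtrancl_into_rtrancl)
  then show "\<exists>i\<le>m. s = u i \<and> chain_edges u i \<subseteq> \<phi> \<Longrightarrow> (s, v) \<in> \<phi>\<^sup>*" by auto
qed

definition chain_prob :: "('a \<times> 'a \<Rightarrow> real) \<Rightarrow> (nat \<Rightarrow> 'a) \<Rightarrow> nat \<Rightarrow> real" where
  "chain_prob p u i = prod p (chain_edges u i)"

lemma chain_prob_nonneg:
  assumes "\<forall>e\<in>E. 0 \<le> p e \<and> p e \<le> 1" "ancestor_chain E v m u" "i \<le> m"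
  shows "0 \<le> chain_prob p u i"
  unfolding chain_prob_def using ancestor_chain_edges_subset[OF assms(2,3)] assms(1)
  by (intro prod_nonneg) auto

lemma chain_prob_Suc_le:
  assumes "\<forall>e\<in>E. 0 \<le> p e \<and> p e \<le> 1" "ancestor_chain E v m u" "Suc i \<le> m"
  shows "chain_prob p u (Suc i) \<le> chain_prob p u i"
proof (cases "(u (Suc i), u i) \<in> chain_edges u i")
  \<comment> \<open>A repeated edge would leave the product unchanged; treating this case separately
    avoids an appeal to injectivity.\<close>
  case True
  then show ?thesis by (simp add: chain_prob_def insert_absorb)
next
  case False
  have "finite (chain_edges u i)" by (simp add: chain_edges_def)
  moreover have "(u (Suc i), u i) \<in> E"
    using ancestor_chain_edges_subset[OF assms(2,3)] by simp
  moreover have "0 \<le> chain_prob p u i" using chain_prob_nonneg assms by (metis Suc_leD)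
  ultimately show ?thesis using False assms(1)
    by (auto simp: chain_prob_def intro!: mult_left_le_one_le)
qed

subsection \<open>Adaptive policies\<close>

text \<open>A node that cannot reach \<open>v\<close> never meets the tail of an edge in
  \<open>C\<close>, because all these tails reach \<open>v\<close>. Changing \<open>C\<close> is
  therefore invisible from it.\<close>

lemma reach_agree_off:
  assumes diff: "\<phi>' - C = \<phi> - C"
    and tail: "\<And>a b. (a, b) \<in> C \<Longrightarrow> (a, v) \<in> \<phi>\<^sup>*" and s: "(s, v) \<notin> \<phi>\<^sup>*"
  shows "reach \<phi>' {s} = reach \<phi> {s}"
proof -
  have iff: "(a, b) \<in> \<phi>' \<longleftrightarrow> (a, b) \<in> \<phi>" if "(s, a) \<in> \<phi>\<^sup>*" for a b
  proof -
    have "(a, b) \<notin> C" using tail that s by (meson rtrancl_trans)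
    then show ?thesis using diff by blast
  qed
  have "(s, a) \<in> \<phi>\<^sup>*" if "(s, a) \<in> \<phi>'\<^sup>*" for a
    using that by induction (auto simp: iff intro: rtrancl_into_rtrancl)
  moreover have "(s, a) \<in> \<phi>'\<^sup>*" if "(s, a) \<in> \<phi>\<^sup>*" for a
    using that
  proof induction
    case (step y z)
    then show ?case using iff[of y z] by (meson rtrancl_into_rtrancl)
  qed simp
  ultimately show ?thesis unfolding reach_def by auto
qed

text \<open>While no seed reaches \<open>v\<close>, no feedback reveals an edge of \<open>C\<close>.
  The policy sees only the feedback, so it makes the same choices under both realizations.\<close>

lemma history_agree_off:
  assumes diff: "\<phi>' - C = \<phi> - C"
    and tail: "\<And>a b. (a, b) \<in> C \<Longrightarrow> (a, v) \<in> \<phi>\<^sup>*"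
    and s: "\<And>s. s \<in> fst ` set (history E \<pi> \<phi> n) \<Longrightarrow> (s, v) \<notin> \<phi>\<^sup>*"
  shows "history E \<pi> \<phi>' n = history E \<pi> \<phi> n"
  using s
proof (induction n)
  case (Suc n)
  have IH: "history E \<pi> \<phi>' n = history E \<pi> \<phi> n"
    using Suc.prems by (intro Suc.IH) (auto split: option.splits)
  show ?case
  proof (cases "\<pi> (history E \<pi> \<phi> n)")
    case (Some t)
    then have t: "(t, v) \<notin> \<phi>\<^sup>*" using Suc.prems by auto
    have "feedback E \<phi>' t = feedback E \<phi> t"
    proof
      fix e
      have "e \<in> \<phi>' \<longleftrightarrow> e \<in> \<phi>" if "fst e \<in> reach \<phi> {t}"
      proof -
        have "e \<notin> C" using tail[of "fst e" "snd e"] that t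
          unfolding reach_def by (auto dest: rtrancl_trans)
        then show ?thesis using diff by blast
      qed
      then show "feedback E \<phi>' t e = feedback E \<phi> t e"
        using reach_agree_off[OF diff tail t] by (simp add: feedback_def)
    qed
    then show ?thesis using IH Some by simp
  qed (use IH in simp)
qed simp

lemma policy_seedsI: "\<pi> (history E \<pi> \<phi> n) = Some s \<Longrightarrow> s \<in> policy_seeds E \<pi> \<phi>"
  unfolding policy_seeds_def by (intro UN_I[of "Suc n"]) auto

lemma policy_seeds_subset:
  assumes "\<forall>\<psi> v. \<pi> \<psi> = Some v \<longrightarrow> v \<in> V"
  shows "policy_seeds E \<pi> \<phi> \<subseteq> V"
proof -
  have "fst ` set (history E \<pi> \<phi> n) \<subseteq> V" for n
    using assms by (induction n) (auto split: option.splits)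
  then show ?thesis unfolding policy_seeds_def by auto
qed

text \<open>It yields the moment of selection along with the seed, since comparing runs under two
  realizations requires the history before that moment.\<close>

lemma first_seed_with_property:
  assumes "s \<in> policy_seeds E \<pi> \<phi>" "Q s"
  obtains n t where "\<pi> (history E \<pi> \<phi> n) = Some t" "Q t"
    "\<And>s. s \<in> fst ` set (history E \<pi> \<phi> n) \<Longrightarrow> \<not> Q s"
proof -
  let ?R = "\<lambda>n. \<exists>s\<in>fst ` set (history E \<pi> \<phi> n). Q s"
  have "\<exists>n. ?R n" using assms unfolding policy_seeds_def by auto
  then obtain n where n: "\<not> ?R n" "?R (Suc n)"
  proof -
    have "\<exists>n. \<not> ?R n \<and> ?R (Suc n)"
    proof (rule ccontr)
      assume *: "\<nexists>n. \<not> ?R n \<and> ?R (Suc n)"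
      have "\<not> ?R n" for n by (induction n) (use * in \<open>simp, blast\<close>)
      then show False using \<open>\<exists>n. ?R n\<close> by blast
    qed
    then show ?thesis using that by blast
  qed
  then obtain t where "\<pi> (history E \<pi> \<phi> n) = Some t" "Q t"
    by (auto split: option.splits)
  then show ?thesis using n(1) that by blast
qed

text \<open>Union bound over the chain position of the first selected seed that reaches
  \<open>v\<close>. A position \<open>i < j\<close> gives \<open>N i\<close>; a position at least
  \<open>j\<close> makes the path from \<open>u j\<close> live, which is \<open>L\<close>. For
  \<open>j = Suc m\<close> every position is below \<open>j\<close>, hence the term 0.\<close>

lemma adaptive_activation_bound:
  fixes \<pi> :: "'a policy"
  assumes fin: "finite E" and p: "\<forall>e\<in>E. 0 \<le> p e \<and> p e \<le> 1" and ch: "ancestor_chain E v m u"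
    and j: "j \<le> Suc m"
  defines "x \<equiv> \<lambda>w. event_prob E p {\<phi>\<in>Pow E. w \<in> policy_seeds E \<pi> \<phi>}"
  shows "event_prob E p {\<phi>\<in>Pow E. v \<in> reach \<phi> (policy_seeds E \<pi> \<phi>)} \<le>
    (if j \<le> m then chain_prob p u j else 0) + (\<Sum>i<j. x (u i) * chain_prob p u i)"
proof -
  define N where "N i = {\<phi>\<in>Pow E. chain_edges u i \<subseteq> \<phi> \<and> (\<exists>n. \<pi> (history E \<pi> \<phi> n) = Some (u i) \<and>
    (\<forall>s\<in>fst ` set (history E \<pi> \<phi> n). (s, v) \<notin> \<phi>\<^sup>*))}" for i
  define L where "L = (if j \<le> m then {\<phi>\<in>Pow E. chain_edges u j \<subseteq> \<phi>} else {})"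
  have N: "event_prob E p (N i) \<le> x (u i) * chain_prob p u i" if "i < j" for i
  proof -
    have im: "i \<le> m" using that j by simp
    have CE: "chain_edges u i \<subseteq> E" by (rule ancestor_chain_edges_subset[OF ch im])
    show ?thesis unfolding x_def chain_prob_def
    \<comment> \<open>Resampling the path from \<open>u i\<close> preserves the run up to the choice
      of \<open>u i\<close>, so the larger event only asks that \<open>u i\<close> be
      selected.\<close>
    proof (rule event_prob_resample[OF fin CE p])
      fix \<phi> D assume \<phi>: "\<phi> \<in> N i" and D: "D \<subseteq> chain_edges u i"
      let ?\<phi>' = "(\<phi> - chain_edges u i) \<union> D"
      obtain n where n: "\<pi> (history E \<pi> \<phi> n) = Some (u i)"
        "\<And>s. s \<in> fst ` set (history E \<pi> \<phi> n) \<Longrightarrow> (s, v) \<notin> \<phi>\<^sup>*"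
        and C: "chain_edges u i \<subseteq> \<phi>" and \<phi>E: "\<phi> \<subseteq> E"
        using \<phi> unfolding N_def by auto
      \<comment> \<open>A path edge starts at some \<open>u (Suc l)\<close> with
        \<open>Suc l \<le> i\<close>, from where the rest of the path is live.\<close>
      have tail: "(a, v) \<in> \<phi>\<^sup>*" if "(a, b) \<in> chain_edges u i" for a b
      proof -
        obtain l where l: "l < i" "a = u (Suc l)" using \<open>(a, b) \<in> _\<close> unfolding chain_edges_def by auto
        then have "chain_edges u (Suc l) \<subseteq> \<phi>" using chain_edges_mono[of "Suc l" i u] C by auto
        then show ?thesis using l im ancestor_chain_reach_iff[OF ch \<phi>E] by (metis Suc_leI order_trans)
      qed
      have "history E \<pi> ?\<phi>' n = history E \<pi> \<phi> n"
        by (rule history_agree_off[OF _ tail n(2)]) (use D in auto)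
      then have "\<pi> (history E \<pi> ?\<phi>' n) = Some (u i)" using n(1) by simp
      then have "u i \<in> policy_seeds E \<pi> ?\<phi>'" by (rule policy_seedsI)
      then show "?\<phi>' \<in> {\<phi>\<in>Pow E. u i \<in> policy_seeds E \<pi> \<phi>}" using \<phi>E D CE by auto
    qed (auto simp: N_def)
  qed
  have L: "event_prob E p L \<le> (if j \<le> m then chain_prob p u j else 0)"
    using event_prob_live_edges[OF fin ancestor_chain_edges_subset[OF ch]]
    by (auto simp: L_def chain_prob_def event_prob_def)
  have "{\<phi>\<in>Pow E. v \<in> reach \<phi> (policy_seeds E \<pi> \<phi>)} \<subseteq> L \<union> (\<Union>i<j. N i)"
  proof
    fix \<phi> assume "\<phi> \<in> {\<phi>\<in>Pow E. v \<in> reach \<phi> (policy_seeds E \<pi> \<phi>)}"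
    then obtain s where \<phi>: "\<phi> \<subseteq> E" and s: "s \<in> policy_seeds E \<pi> \<phi>" "(s, v) \<in> \<phi>\<^sup>*"
      unfolding reach_def by auto
    obtain n t where n: "\<pi> (history E \<pi> \<phi> n) = Some t" "(t, v) \<in> \<phi>\<^sup>*"
      "\<And>s. s \<in> fst ` set (history E \<pi> \<phi> n) \<Longrightarrow> (s, v) \<notin> \<phi>\<^sup>*"
      using first_seed_with_property[OF s(1), of "\<lambda>s. (s, v) \<in> \<phi>\<^sup>*"] s(2) by metis
    obtain i where i: "i \<le> m" "t = u i" "chain_edges u i \<subseteq> \<phi>"
      using n(2) ancestor_chain_reach_iff[OF ch \<phi>] by auto
    show "\<phi> \<in> L \<union> (\<Union>i<j. N i)"
    proof (cases "i < j")
      case True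
      then show ?thesis using n i \<phi> unfolding N_def by blast
    next
      case False
      \<comment> \<open>The path from \<open>u i\<close> contains the one from \<open>u j\<close>,
        and \<open>j \<le> i \<le> m\<close> selects the nonempty branch of
        \<open>L\<close>.\<close>
      then show ?thesis using chain_edges_mono[of j i u] i \<phi> unfolding L_def by auto
    qed
  qed
  then have "event_prob E p {\<phi>\<in>Pow E. v \<in> reach \<phi> (policy_seeds E \<pi> \<phi>)} \<le>
      event_prob E p (L \<union> (\<Union>i<j. N i))"
    using fin p by (intro event_prob_mono) (auto simp: L_def N_def)
  also have "\<dots> \<le> event_prob E p L + event_prob E p (\<Union>i<j. N i)"
    using fin p by (intro event_prob_Un) (auto simp: L_def N_def)
  also have "event_prob E p (\<Union>i<j. N i) \<le> (\<Sum>i<j. event_prob E p (N i))"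
    using fin p by (intro event_prob_UN) (auto simp: N_def)
  also have "\<dots> \<le> (\<Sum>i<j. x (u i) * chain_prob p u i)"
    using N by (intro sum_mono) auto
  finally show ?thesis using L by linarith
qed

subsection \<open>Non-adaptive seed sets\<close>

text \<open>If \<open>u i\<close> is the seed nearest to \<open>v\<close>, the indicator is 1
  exactly for \<open>j \<ge> i\<close>, so the sum telescopes to \<open>q i\<close>, the probability
  that this seed alone reaches \<open>v\<close>. In this form \<open>S\<close> enters only through
  which prefixes of the chain it hits.\<close>

lemma nonadaptive_activation_bound:
  assumes fin: "finite E" and p: "\<forall>e\<in>E. 0 \<le> p e \<and> p e \<le> 1" and ch: "ancestor_chain E v m u"
  defines "q \<equiv> \<lambda>j. if j \<le> m then chain_prob p u j else 0"
  shows "(\<Sum>j\<le>m. (q j - q (Suc j)) * of_bool (S \<inter> u ` {..j} \<noteq> {})) \<le>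
    event_prob E p {\<phi>\<in>Pow E. v \<in> reach \<phi> S}"
proof (cases "\<exists>i\<le>m. u i \<in> S")
  case True
  define i where "i = (LEAST i. u i \<in> S)"
  have i: "u i \<in> S" "i \<le> m" "\<And>l. l < i \<Longrightarrow> u l \<notin> S"
    using True unfolding i_def by (auto intro: LeastI dest: not_less_Least) (meson Least_le order_trans)
  have "(\<Sum>j\<le>m. (q j - q (Suc j)) * of_bool (S \<inter> u ` {..j} \<noteq> {})) = (\<Sum>j=i..m. q j - q (Suc j))"
  proof (rule sum.mono_neutral_cong_right)
    show "\<forall>j\<in>{..m} - {i..m}. (q j - q (Suc j)) * of_bool (S \<inter> u ` {..j} \<noteq> {}) = 0"
      using i by auto
    show "(q j - q (Suc j)) * of_bool (S \<inter> u ` {..j} \<noteq> {}) = q j - q (Suc j)" if "j \<in> {i..m}" for j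
    proof -
      have "u i \<in> S \<inter> u ` {..j}" using i that by auto
      then have "S \<inter> u ` {..j} \<noteq> {}" by blast
      then show ?thesis by simp
    qed
  qed auto
  \<comment> \<open>The upper boundary term is \<open>q (Suc m) = 0\<close>.\<close>
  also have "\<dots> = q i" using sum_Suc_diff[of i m "\<lambda>j. - q j"] i(2) by (simp add: q_def)
  also have "q i = event_prob E p {\<phi>\<in>Pow E. chain_edges u i \<subseteq> \<phi>}"
    using event_prob_live_edges[OF fin ancestor_chain_edges_subset[OF ch i(2)]] i(2)
    by (simp add: q_def chain_prob_def)
  also have "\<dots> \<le> event_prob E p {\<phi>\<in>Pow E. v \<in> reach \<phi> S}"
  proof (rule event_prob_mono[OF fin p])
    show "{\<phi>\<in>Pow E. chain_edges u i \<subseteq> \<phi>} \<subseteq> {\<phi>\<in>Pow E. v \<in> reach \<phi> S}"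
      using i ancestor_chain_reach_iff[OF ch] unfolding reach_def by blast
  qed auto
  finally show ?thesis .
next
  case False
  then have "(\<Sum>j\<le>m. (q j - q (Suc j)) * of_bool (S \<inter> u ` {..j} \<noteq> {})) = 0"
    by (intro sum.neutral) auto
  then show ?thesis using p by (auto simp: event_prob_def intro!: sum_nonneg real_prob_nonneg)
qed

text \<open>Derandomizes drawing \<open>n\<close> independent samples from \<open>y\<close> by conditional expectations.\<close>

lemma hitting_set_exists:
  fixes y :: "'a \<Rightarrow> real" and c :: "'t \<Rightarrow> real"
  assumes "finite V" "V \<noteq> {}" "finite T" and y: "\<And>s. s \<in> V \<Longrightarrow> 0 \<le> y s" "sum y V \<le> 1"
    and P: "\<And>t. t \<in> T \<Longrightarrow> P t \<subseteq> V" and c: "\<And>t. t \<in> T \<Longrightarrow> 0 \<le> c t"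
  shows "\<exists>S\<subseteq>V. card S \<le> n \<and> (\<Sum>t\<in>T. c t * of_bool (S \<inter> P t = {})) \<le> (\<Sum>t\<in>T. c t * (1 - sum y (P t)) ^ n)"
  using c
proof (induction n arbitrary: c)
  case 0
  then show ?case by (intro exI[of _ "{}"]) simp
next
  case (Suc n)
  define d where "d t = c t * (1 - sum y (P t)) ^ n" for t
  \<comment> \<open>The expected weight of missed sets if the first sample is \<open>s\<close> and
    \<open>n\<close> further samples follow; the first element is chosen to minimize it.\<close>
  define g where "g s = (\<Sum>t\<in>T. d t * of_bool (s \<notin> P t))" for s
  have yP: "sum y (P t) \<le> 1" if "t \<in> T" for t
  proof -
    have "sum y (P t) \<le> sum y V" using assms P[OF that] by (intro sum_mono2) auto
    then show ?thesis using y by simp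
  qed
  have d: "0 \<le> d t" if "t \<in> T" for t
    using yP[OF that] Suc.prems[OF that] by (simp add: d_def)
  define s where "s = arg_min_on g V"
  have s: "s \<in> V" "\<And>s'. s' \<in> V \<Longrightarrow> g s \<le> g s'"
    using arg_min_if_finite[OF assms(1,2), of g] arg_min_least[OF assms(1,2), of _ g]
    unfolding s_def by auto
  \<comment> \<open>\<open>y\<close> may have mass below 1. The missing mass stands for a sample
    that hits nothing and costs \<open>sum d T\<close>, which is at least
    \<open>g s\<close>.\<close>
  have "g s = (\<Sum>s'\<in>V. y s' * g s) + (1 - sum y V) * g s"
    by (simp add: left_diff_distrib flip: sum_distrib_right)
  also have "\<dots> \<le> (\<Sum>s'\<in>V. y s' * g s') + (1 - sum y V) * sum d T"
    using y s d by (intro add_mono sum_mono mult_left_mono) (auto simp: g_def intro!: sum_mono)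
  also have "(\<Sum>s'\<in>V. y s' * g s') = (\<Sum>t\<in>T. d t * (sum y V - sum y (P t)))"
  proof -
    have "(\<Sum>s'\<in>V. y s' * g s') = (\<Sum>s'\<in>V. \<Sum>t\<in>T. y s' * (d t * of_bool (s' \<notin> P t)))"
      by (simp add: g_def sum_distrib_left)
    also have "\<dots> = (\<Sum>t\<in>T. \<Sum>s'\<in>V. y s' * (d t * of_bool (s' \<notin> P t)))" by (rule sum.swap)
    also have "\<dots> = (\<Sum>t\<in>T. d t * (\<Sum>s'\<in>V. y s' * of_bool (s' \<notin> P t)))"
      by (simp add: sum_distrib_left mult.left_commute)
    also have "\<dots> = (\<Sum>t\<in>T. d t * (sum y V - sum y (P t)))"
    proof (rule sum.cong[OF refl])
      fix t assume "t \<in> T"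
      then have "(\<Sum>s'\<in>V. y s' * of_bool (s' \<notin> P t)) = sum y (V - P t)"
        using assms(1) by (intro sum.mono_neutral_cong_right) auto
      then show "d t * (\<Sum>s'\<in>V. y s' * of_bool (s' \<notin> P t)) = d t * (sum y V - sum y (P t))"
        using assms(1) P[OF \<open>t \<in> T\<close>] by (simp add: sum_diff)
    qed
    finally show ?thesis .
  qed
  also have "\<dots> + (1 - sum y V) * sum d T = (\<Sum>t\<in>T. d t * (1 - sum y (P t)))"
    by (simp add: sum_distrib_left sum_distrib_right algebra_simps flip: sum.distrib)
  finally have gs: "g s \<le> (\<Sum>t\<in>T. c t * (1 - sum y (P t)) ^ Suc n)"
    by (simp add: d_def mult_ac)
  \<comment> \<open>Sets already hit by \<open>s\<close> get weight 0, so \<open>S\<close> only has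
    to deal with the others.\<close>
  obtain S where S: "S \<subseteq> V" "card S \<le> n"
    "(\<Sum>t\<in>T. c t * of_bool (s \<notin> P t) * of_bool (S \<inter> P t = {})) \<le>
      (\<Sum>t\<in>T. c t * of_bool (s \<notin> P t) * (1 - sum y (P t)) ^ n)"
    using Suc.IH[of "\<lambda>t. c t * of_bool (s \<notin> P t)"] Suc.prems by auto
  have "(\<Sum>t\<in>T. c t * of_bool (insert s S \<inter> P t = {})) =
      (\<Sum>t\<in>T. c t * of_bool (s \<notin> P t) * of_bool (S \<inter> P t = {}))"
    by (intro sum.cong) auto
  also have "\<dots> \<le> g s" using S(3) by (simp add: g_def d_def mult_ac)
  finally have "(\<Sum>t\<in>T. c t * of_bool (insert s S \<inter> P t = {})) \<le> (\<Sum>t\<in>T. c t * (1 - sum y (P t)) ^ Suc n)"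
    using gs by linarith
  moreover have "card (insert s S) \<le> Suc n" using S(2) by (metis card_insert_le_m1 diff_Suc_1 zero_less_Suc)
  ultimately show ?case using s S by (intro exI[of _ "insert s S"]) auto
qed

subsection \<open>Comparison of adaptive and non-adaptive influence\<close>

text \<open>Source of the constant 2. In the extremal case \<open>D = q > 0\<close> the claim
  amounts to \<open>exp (- x) * (1 + x) \<le> 1\<close>, and a factor above 1/2 would fail as
  \<open>x\<close> tends to 0. Each case regroups the difference of the two sides into nonnegative
  terms.\<close>

lemma discount_step:
  fixes q D x :: real
  assumes "0 \<le> q" "D \<le> q" "0 \<le> x"
  shows "D / 2 \<le> q * (1 - exp (- x)) + (D - x * q) * exp (- x) / 2"
proof -
  have e: "exp (- x) * (1 + x) \<le> 1"
    using exp_ge_add_one_self[of x] by (simp add: exp_minus field_simps)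
  have "exp (- x) * (1 + x / 2) \<le> exp (- x) * (1 + x)"
    using assms by (intro mult_left_mono) auto
  with e have e2: "exp (- x) * (1 + x / 2) \<le> 1" by linarith
  show ?thesis
  proof (cases "0 \<le> D")
    case True
    have "0 \<le> (q - D) * (1 - exp (- x) * (1 + x / 2)) + D * (1 - exp (- x) * (1 + x)) / 2"
      using assms e e2 True by simp
    then show ?thesis by (simp add: field_simps)
  next
    case False
    have "0 \<le> q * (1 - exp (- x) * (1 + x / 2))" "0 \<le> (- D) * (1 - exp (- x))"
      using assms e2 False by (auto intro: mult_nonpos_nonneg)
    then show ?thesis by (simp add: field_simps)
  qed
qed

text \<open>
  In the invariant \<open>inv\<close>, the summand with \<open>q n\<close> is the boundary term of a summation by parts. The
  last summand is half the discounted deficit \<open>P - (\<Sum>i<n. x i * q i)\<close>, a lower bound for what the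
  remaining terms contribute, since \<open>q n\<close> is at least the deficit.
\<close>

lemma discounted_sum_ge_half:
  fixes q x :: "nat \<Rightarrow> real"
  assumes "\<And>n. n \<le> m \<Longrightarrow> 0 \<le> q n" "\<And>n. 0 \<le> x n" "q (Suc m) = 0"
    and P: "\<And>n. n \<le> Suc m \<Longrightarrow> P \<le> q n + (\<Sum>i<n. x i * q i)"
  shows "P / 2 \<le> (\<Sum>j\<le>m. (q j - q (Suc j)) * (1 - exp (- (\<Sum>i\<le>j. x i))))"
proof -
  have inv: "P / 2 \<le> (\<Sum>j<n. (q j - q (Suc j)) * (1 - exp (- (\<Sum>i\<le>j. x i)))) +
      q n * (1 - exp (- (\<Sum>i<n. x i))) + (P - (\<Sum>i<n. x i * q i)) * exp (- (\<Sum>i<n. x i)) / 2"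
    if "n \<le> Suc m" for n
    using that
  proof (induction n)
    case (Suc n)
    define a where "a = (\<Sum>i<n. x i)"
    define D where "D = P - (\<Sum>i<n. x i * q i)"
    define R where "R = (\<Sum>j<n. (q j - q (Suc j)) * (1 - exp (- (\<Sum>i\<le>j. x i))))"
    have "D / 2 \<le> q n * (1 - exp (- x n)) + (D - x n * q n) * exp (- x n) / 2"
      using assms(1)[of n] assms(2)[of n] P[of n] Suc.prems by (intro discount_step) (auto simp: D_def)
    \<comment> \<open>\<open>exp (- a)\<close> is the discount accumulated so far; the scaled
      inequality bounds the last term of the induction hypothesis.\<close>
    then have "D / 2 * exp (- a) \<le> (q n * (1 - exp (- x n)) + (D - x n * q n) * exp (- x n) / 2) * exp (- a)"
      by (intro mult_right_mono) auto
    moreover have "exp (- (a + x n)) = exp (- x n) * exp (- a)" by (simp flip: exp_add)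
    moreover have "P / 2 \<le> R + q n * (1 - exp (- a)) + D * exp (- a) / 2"
      using Suc by (simp add: R_def D_def a_def)
    ultimately have "P / 2 \<le> R + (q n - q (Suc n)) * (1 - exp (- (a + x n))) +
        q (Suc n) * (1 - exp (- (a + x n))) + (D - x n * q n) * exp (- (a + x n)) / 2"
      by (simp add: field_simps)
    then show ?case
      by (simp add: R_def D_def a_def lessThan_Suc_atMost[symmetric] diff_diff_eq)
  qed simp
  have "(P - (\<Sum>i<Suc m. x i * q i)) * exp (- (\<Sum>i<Suc m. x i)) / 2 \<le> 0"
    using P[of "Suc m"] assms(3) by (simp add: mult_nonpos_nonneg)
  then show ?thesis using inv[of "Suc m"] assms(3) by (simp add: lessThan_Suc_atMost)
qed

text \<open>One set has to serve all nodes at once, so the contributions of all nodes and all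
  prefixes of their chains are pooled before derandomizing.\<close>

lemma nonadaptive_set_half_of_policy:
  assumes G: "influence_graph V E p" "out_arborescence V E" and k: "k \<ge> 1"
    and \<pi>: "\<pi> \<in> policies V E k"
  obtains S where "S \<subseteq> V" "card S \<le> k" "sigma_A E p \<pi> \<le> 2 * sigma_N E p S"
proof -
  have fV: "finite V" and V: "V \<noteq> {}" and EV: "E \<subseteq> V \<times> V" and p: "\<forall>e\<in>E. 0 \<le> p e \<and> p e \<le> 1"
    using G unfolding influence_graph_def by auto
  have fE: "finite E" using fV EV finite_subset by auto
  have \<pi>V: "policy_seeds E \<pi> \<phi> \<subseteq> V" for \<phi>
    using \<pi> by (intro policy_seeds_subset) (auto simp: policies_def)
  have \<pi>k: "card (policy_seeds E \<pi> \<phi>) \<le> k" if "\<phi> \<subseteq> E" for \<phi>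
    using \<pi> that by (auto simp: policies_def)
  have reachV: "reach \<phi> S \<subseteq> V" if "\<phi> \<subseteq> E" "S \<subseteq> V" for \<phi> S
  proof -
    have "b \<in> V" if "(a, b) \<in> \<phi>\<^sup>*" "a \<in> V" for a b
      using that by induction (use \<open>\<phi> \<subseteq> E\<close> EV in auto)
    then show ?thesis using that unfolding reach_def by auto
  qed
  define x where "x w = event_prob E p {\<phi>\<in>Pow E. w \<in> policy_seeds E \<pi> \<phi>}" for w
  have x0: "0 \<le> x w" for w
    using p by (auto simp: x_def event_prob_def intro!: sum_nonneg real_prob_nonneg)
  have "sum x V = (\<Sum>\<phi>\<in>Pow E. real_prob E p \<phi> * real (card (policy_seeds E \<pi> \<phi>)))"
    unfolding x_def using expected_card[OF fE fV, of "policy_seeds E \<pi>"] \<pi>V by simp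
  also have "\<dots> \<le> (\<Sum>\<phi>\<in>Pow E. real_prob E p \<phi> * real k)"
    using p \<pi>k by (intro sum_mono mult_left_mono) (auto intro: real_prob_nonneg)
  also have "\<dots> = real k" by (simp add: sum_real_prob fE flip: sum_distrib_right)
  finally have xk: "sum x V \<le> real k" .

  have "\<forall>v\<in>V. \<exists>m u. ancestor_chain E v m u"
    using ancestor_chain_exists[OF G(2) fE] by metis
  then obtain m u where ch: "\<And>v. v \<in> V \<Longrightarrow> ancestor_chain E v (m v) (u v)"
    unfolding bchoice_iff by blast
  \<comment> \<open>Extension by 0 past the root makes the last increment \<open>c v (m v)\<close>
    equal to \<open>q v (m v)\<close>.\<close>
  define q where "q v j = (if j \<le> m v then chain_prob p (u v) j else 0)" for v j
  define c where "c v j = q v j - q v (Suc j)" for v j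
  have q0: "0 \<le> q v j" if "v \<in> V" for v j
    using chain_prob_nonneg[OF p ch[OF that]] by (simp add: q_def)
  have c0: "0 \<le> c v j" if "v \<in> V" for v j
    using chain_prob_Suc_le[OF p ch[OF that], of j] q0[OF that, of j]
    by (auto simp: c_def q_def split: if_splits)
  have uV: "u v ` {..j} \<subseteq> V" if "v \<in> V" "j \<le> m v" for v j
  proof
    fix w assume "w \<in> u v ` {..j}"
    then obtain i where i: "i \<le> j" "w = u v i" by auto
    show "w \<in> V"
    proof (cases i)
      case 0
      then show ?thesis using i ch[OF that(1)] that by (simp add: ancestor_chain_def)
    next
      case (Suc l)
      then have "(w, u v l) \<in> E" using i ch[OF that(1)] that by (simp add: ancestor_chain_def)
      then show ?thesis using EV by auto
    qed
  qed
  \<comment> \<open>Injectivity matters here: a repeated ancestor would count only once in the sum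
    over the image.\<close>
  have sum_u: "sum x (u v ` {..j}) = (\<Sum>i\<le>j. x (u v i))" if "v \<in> V" "j \<le> m v" for v j
    using inj_on_subset[OF ancestor_chain_inj[OF ch[OF that(1)]], of "{..j}"] that
    by (simp add: sum.reindex)
  define T where "T = (SIGMA v:V. {..m v})"
  \<comment> \<open>The policy selects at most \<open>k\<close> seeds in expectation, so
    \<open>y\<close> has total mass at most 1.\<close>
  define y where "y w = x w / real k" for w
  have "sum y V \<le> 1" using xk k by (simp add: y_def flip: sum_divide_distrib)
  then obtain S where S: "S \<subseteq> V" "card S \<le> k" and hit:
    "(\<Sum>t\<in>T. case_prod c t * of_bool (S \<inter> (case t of (v, j) \<Rightarrow> u v ` {..j}) = {})) \<le>
      (\<Sum>t\<in>T. case_prod c t * (1 - sum y (case t of (v, j) \<Rightarrow> u v ` {..j})) ^ k)"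
    using hitting_set_exists[OF fV V, of T y "\<lambda>(v, j). u v ` {..j}" "case_prod c" k] c0 uV x0 fV
    by (auto simp: T_def y_def)
  have "sigma_A E p \<pi> = (\<Sum>v\<in>V. event_prob E p {\<phi>\<in>Pow E. v \<in> reach \<phi> (policy_seeds E \<pi> \<phi>)})"
    unfolding sigma_A_def using reachV \<pi>V by (intro expected_card[OF fE fV]) auto
  also have "\<dots> \<le> (\<Sum>v\<in>V. 2 * (\<Sum>j\<le>m v. c v j * (1 - exp (- (\<Sum>i\<le>j. x (u v i))))))"
  proof (rule sum_mono)
    fix v assume v: "v \<in> V"
    let ?P = "event_prob E p {\<phi>\<in>Pow E. v \<in> reach \<phi> (policy_seeds E \<pi> \<phi>)}"
    have "?P / 2 \<le> (\<Sum>j\<le>m v. (q v j - q v (Suc j)) * (1 - exp (- (\<Sum>i\<le>j. x (u v i)))))"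
    proof (rule discounted_sum_ge_half)
      show "?P \<le> q v n + (\<Sum>i<n. x (u v i) * q v i)" if "n \<le> Suc (m v)" for n
      proof -
        have "(\<Sum>i<n. x (u v i) * q v i) = (\<Sum>i<n. x (u v i) * chain_prob p (u v) i)"
          using that by (intro sum.cong) (auto simp: q_def)
        then show ?thesis
          using adaptive_activation_bound[OF fE p ch[OF v] that, where \<pi> = \<pi>] by (simp add: q_def x_def)
      qed
      show "q v (Suc (m v)) = 0" by (simp add: q_def)
    qed (use q0 x0 v in auto)
    then show "?P \<le> 2 * (\<Sum>j\<le>m v. c v j * (1 - exp (- (\<Sum>i\<le>j. x (u v i)))))"
      by (simp add: c_def)
  qed
  also have "\<dots> = 2 * (\<Sum>(v, j)\<in>T. c v j * (1 - exp (- (\<Sum>i\<le>j. x (u v i)))))"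
    using fV by (simp add: T_def sum.Sigma sum_distrib_left case_prod_unfold)
  also have "\<dots> \<le> 2 * (\<Sum>(v, j)\<in>T. c v j * of_bool (S \<inter> u v ` {..j} \<noteq> {}))"
  proof -
    have "(\<Sum>t\<in>T. case_prod c t * (1 - sum y (case t of (v, j) \<Rightarrow> u v ` {..j})) ^ k) \<le>
        (\<Sum>(v, j)\<in>T. c v j * exp (- (\<Sum>i\<le>j. x (u v i))))"
    proof (rule sum_mono)
      fix t assume "t \<in> T"
      then obtain v j where t: "t = (v, j)" and v: "v \<in> V" "j \<le> m v" by (auto simp: T_def)
      have le: "sum x (u v ` {..j}) \<le> real k"
        using sum_mono2[OF fV uV[OF v], of x] x0 xk by auto
      \<comment> \<open>Bounds the probability that \<open>k\<close> samples all miss the prefix;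
        \<open>le\<close> keeps the base nonnegative.\<close>
      have "(1 - sum x (u v ` {..j}) / real k) ^ k \<le> exp (- sum x (u v ` {..j}))"
        using le k by (intro exp_ge_one_minus_x_over_n_power_n) auto
      then show "case_prod c t * (1 - sum y (case t of (v, j) \<Rightarrow> u v ` {..j})) ^ k \<le>
          (case t of (v, j) \<Rightarrow> c v j * exp (- (\<Sum>i\<le>j. x (u v i))))"
        using c0[OF v(1)] sum_u[OF v] by (auto simp: t y_def intro!: mult_left_mono simp flip: sum_divide_distrib)
    qed
    with hit have "(\<Sum>(v, j)\<in>T. c v j * of_bool (S \<inter> u v ` {..j} = {})) \<le>
        (\<Sum>(v, j)\<in>T. c v j * exp (- (\<Sum>i\<le>j. x (u v i))))"
      by (simp add: case_prod_unfold)
    moreover have "(\<Sum>(v, j)\<in>T. c v j * of_bool (S \<inter> u v ` {..j} \<noteq> {})) =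
        (\<Sum>(v, j)\<in>T. c v j) - (\<Sum>(v, j)\<in>T. c v j * of_bool (S \<inter> u v ` {..j} = {}))"
      by (simp add: case_prod_unfold flip: sum_subtractf) (intro sum.cong; simp)
    ultimately show ?thesis
      by (simp add: case_prod_unfold right_diff_distrib sum_subtractf)
  qed
  also have "\<dots> = 2 * (\<Sum>v\<in>V. \<Sum>j\<le>m v. c v j * of_bool (S \<inter> u v ` {..j} \<noteq> {}))"
    unfolding T_def using fV by (subst sum.Sigma) auto
  also have "\<dots> \<le> 2 * (\<Sum>v\<in>V. event_prob E p {\<phi>\<in>Pow E. v \<in> reach \<phi> S})"
    using nonadaptive_activation_bound[OF fE p ch]
    by (intro mult_left_mono sum_mono) (auto simp: c_def q_def)
  also have "\<dots> = 2 * sigma_N E p S"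
    unfolding sigma_N_def using reachV S by (subst expected_card[OF fE fV]) auto
  finally show ?thesis using S that by blast
qed

theorem theorem2:
  fixes V :: "'a set" and E :: "('a \<times> 'a) set" and p :: "'a \<times> 'a \<Rightarrow> real" and k :: nat
  assumes "influence_graph V E p"
    and "out_arborescence V E"
    and "k \<ge> 1"
  shows "OPT_A V E p k / OPT_N V E p k \<le> 2"
proof -
  let ?F = "{S. S \<subseteq> V \<and> card S \<le> k}"
  have "finite V" using assms(1) by (simp add: influence_graph_def)
  then have fin: "finite (sigma_N E p ` ?F)" by simp
  have le: "sigma_N E p S \<le> OPT_N V E p k" if "S \<subseteq> V" "card S \<le> k" for S
    unfolding OPT_N_def using fin that by (intro Max_ge) auto
  have "0 \<le> OPT_N V E p k" using le[of "{}"] by (simp add: sigma_N_def reach_def)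
  moreover have "OPT_A V E p k \<le> 2 * OPT_N V E p k"
    unfolding OPT_A_def
  proof (rule cSUP_least)
    \<comment> \<open>The policy that stops at once shows that the supremum is over a nonempty
      set.\<close>
    have "history E (\<lambda>_. None) \<phi> n = []" for \<phi> n by (induction n) auto
    then have "(\<lambda>_. None) \<in> policies V E k" by (simp add: policies_def policy_seeds_def)
    then show "policies V E k \<noteq> {}" by blast
  next
    fix \<pi> assume "\<pi> \<in> policies V E k"
    from nonadaptive_set_half_of_policy[OF assms this]
    obtain S where "S \<subseteq> V" "card S \<le> k" "sigma_A E p \<pi> \<le> 2 * sigma_N E p S" .
    then show "sigma_A E p \<pi> \<le> 2 * OPT_N V E p k" using le[of S] by linarith
  qed
  \<comment> \<open>Division by 0 yields 0, so splitting off that case replaces a proof that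
    \<open>OPT_N\<close> is positive.\<close>
  ultimately show ?thesis
    by (cases "OPT_N V E p k = 0") (auto simp: divide_le_eq)
qed

end
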